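(* Let $k \geq 1$ and let $r \colon \{0,1,\dots,k\} \to \mathbb{R}_{\geq 0}$ be monotone nondecreasing with $r(0)=0$. Assume that $r(1) \geq r(i)/i$ for every $i \in \{1,2,\dots,k\}$. Then for every instance of $\textsc{swamp}(r)$ there is an optimal solution consisting of a single node.
   Context: An instance of $\textsc{swamp}(r)$ is a hypergraph $H=(V,E,w)$ with maximum hyperedge size $k$ and nonnegative edge weights $w(e)\ge 0$, where every hyperedge uses the same reward function $r$ (restricted to $\{0,\dots,|e|\}$). For a nonempty $S\subseteq V$ let $f(S)=\sum_{e\in E} w(e)\, r(|e\cap S|)$ and $\Gamma(S)=f(S)/|S|$. The problem asks for a nonempty $S\subseteq V$ maximizing $\Gamma(S)$; such a maximizer is an optimal solution. *)

theory Defs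
  imports Complex_Main
begin

definition swamp_instance :: "nat \<Rightarrow> 'a set \<Rightarrow> 'a set set \<Rightarrow> ('a set \<Rightarrow> real) \<Rightarrow> bool" where
  "swamp_instance k V E w \<longleftrightarrow>
     finite V \<and> V \<noteq> {} \<and> E \<subseteq> Pow V \<and>
     (\<forall>e\<in>E. card e \<le> k) \<and> (\<forall>e\<in>E. w e \<ge> 0)"

definition swamp_f :: "'a set set \<Rightarrow> ('a set \<Rightarrow> real) \<Rightarrow> (nat \<Rightarrow> real) \<Rightarrow> 'a set \<Rightarrow> real" where
  "swamp_f E w r S = (\<Sum>e\<in>E. w e * r (card (e \<inter> S)))"

definition swamp_Gamma :: "'a set set \<Rightarrow> ('a set \<Rightarrow> real) \<Rightarrow> (nat \<Rightarrow> real) \<Rightarrow> 'a set \<Rightarrow> real" where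
  "swamp_Gamma E w r S = swamp_f E w r S / real (card S)"

definition swamp_optimal ::
    "'a set \<Rightarrow> 'a set set \<Rightarrow> ('a set \<Rightarrow> real) \<Rightarrow> (nat \<Rightarrow> real) \<Rightarrow> 'a set \<Rightarrow> bool" where
  "swamp_optimal V E w r S \<longleftrightarrow>
     is_arg_max (swamp_Gamma E w r) (\<lambda>T. T \<subseteq> V \<and> T \<noteq> {}) S"

end

theory Submission
  imports Defs
begin

text \<open>The hypothesis says \<open>r i \<le> i * r 1\<close>, so the reward of a set is at most the sum of the
  rewards of its nodes. Hence the density of \<open>S\<close> is at most the average, and so at most the
  maximum, of the densities of single nodes.\<close>

lemma ex_singleton_is_arg_max_average:
  fixes f :: "'a set \<Rightarrow> 'b::linordered_field"
  assumes "finite V" and "V \<noteq> {}"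
    and f_le_sum: "\<And>S. S \<subseteq> V \<Longrightarrow> S \<noteq> {} \<Longrightarrow> f S \<le> (\<Sum>v\<in>S. f {v})"
  shows "\<exists>v\<in>V. is_arg_max (\<lambda>S. f S / of_nat (card S)) (\<lambda>S. S \<subseteq> V \<and> S \<noteq> {}) {v}"
proof -
  obtain v where "v \<in> V" and v_max: "\<And>u. u \<in> V \<Longrightarrow> f {u} \<le> f {v}"
    using ex_is_arg_min_if_finite[OF assms(1,2), of "\<lambda>u. - f {u}"]
    by (auto simp: is_arg_min_linorder)
  have "f S / of_nat (card S) \<le> f {v}" if "S \<subseteq> V" "S \<noteq> {}" for S
  proof -
    have "f S \<le> (\<Sum>u\<in>S. f {u})"
      using that by (rule f_le_sum)
    also have "\<dots> \<le> of_nat (card S) * f {v}"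
      using \<open>S \<subseteq> V\<close> v_max by (intro sum_bounded_above) auto
    finally show ?thesis
      using that \<open>finite V\<close>
      by (simp add: pos_divide_le_eq card_gt_0_iff finite_subset mult.commute)
  qed
  with \<open>v \<in> V\<close> show ?thesis
    by (auto simp: is_arg_max_linorder)
qed

lemma le_linear_if_ratio_le:
  fixes r :: "nat \<Rightarrow> 'a::linordered_field"
  assumes "r 0 = 0" and "\<forall>i\<in>{1..k}. r i / of_nat i \<le> c" and "i \<le> k"
  shows "r i \<le> of_nat i * c"
proof (cases "i = 0")
  case False
  with assms show ?thesis
    by (simp add: pos_divide_le_eq mult.commute)
qed (simp add: \<open>r 0 = 0\<close>)

lemma sum_card_Int_singleton:
  fixes r :: "nat \<Rightarrow> 'b::semiring_1"
  assumes "finite S" and "r 0 = 0"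
  shows "(\<Sum>v\<in>S. r (card (e \<inter> {v}))) = of_nat (card (e \<inter> S)) * r 1"
proof -
  have "(\<Sum>v\<in>S. r (card (e \<inter> {v}))) = (\<Sum>v\<in>S. if v \<in> e then r 1 else 0)"
    using \<open>r 0 = 0\<close> by (intro sum.cong) auto
  also have "\<dots> = (\<Sum>v\<in>S \<inter> e. r 1)"
    using \<open>finite S\<close> by (rule sum.inter_restrict[symmetric])
  finally show ?thesis
    by (simp add: Int_commute)
qed

lemma swamp_f_le_sum_singletons:
  assumes "finite S" and "r 0 = 0"
    and w_nonneg: "\<And>e. e \<in> E \<Longrightarrow> 0 \<le> w e"
    and r_le_linear: "\<And>e. e \<in> E \<Longrightarrow> r (card (e \<inter> S)) \<le> real (card (e \<inter> S)) * r 1"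
  shows "swamp_f E w r S \<le> (\<Sum>v\<in>S. swamp_f E w r {v})"
proof -
  have "swamp_f E w r S \<le> (\<Sum>e\<in>E. w e * (real (card (e \<inter> S)) * r 1))"
    unfolding swamp_f_def by (intro sum_mono mult_left_mono r_le_linear w_nonneg)
  also have "\<dots> = (\<Sum>e\<in>E. \<Sum>v\<in>S. w e * r (card (e \<inter> {v})))"
    using sum_card_Int_singleton[where r = r, OF assms(1,2)] by (simp flip: sum_distrib_left)
  also have "\<dots> = (\<Sum>v\<in>S. swamp_f E w r {v})"
    unfolding swamp_f_def by (rule sum.swap)
  finally show ?thesis .
qed

lemma swamp_instance_card_Int_le:
  assumes "swamp_instance k V E w" and "e \<in> E"
  shows "card (e \<inter> S) \<le> k"
proof -
  have "finite e" and "card e \<le> k"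
    using assms by (auto simp: swamp_instance_def intro: finite_subset[of e V])
  then show ?thesis
    by (meson Int_lower1 card_mono order_trans)
qed

theorem theorem2:
  fixes k :: nat and r :: "nat \<Rightarrow> real"
    and V :: "'a set" and E :: "'a set set" and w :: "'a set \<Rightarrow> real"
  assumes "k \<ge> 1"
    and "\<forall>i\<in>{0..k}. r i \<ge> 0"
    and "mono_on {0..k} r"
    and "r 0 = 0"
    and "\<forall>i\<in>{1..k}. r 1 \<ge> r i / real i"
    and "swamp_instance k V E w"
  shows "\<exists>v\<in>V. swamp_optimal V E w r {v}"
proof -
  have V: "finite V" "V \<noteq> {}" and w_nonneg: "\<And>e. e \<in> E \<Longrightarrow> 0 \<le> w e"
    using \<open>swamp_instance k V E w\<close> by (auto simp: swamp_instance_def)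
  have r_le_linear: "r (card (e \<inter> S)) \<le> real (card (e \<inter> S)) * r 1" if "e \<in> E" for e S
    using \<open>r 0 = 0\<close> \<open>\<forall>i\<in>{1..k}. r 1 \<ge> r i / real i\<close>
      swamp_instance_card_Int_le[OF \<open>swamp_instance k V E w\<close> that]
    by (rule le_linear_if_ratio_le)
  have "swamp_f E w r S \<le> (\<Sum>v\<in>S. swamp_f E w r {v})" if "S \<subseteq> V" for S
    using finite_subset[OF that \<open>finite V\<close>] \<open>r 0 = 0\<close> w_nonneg r_le_linear
    by (rule swamp_f_le_sum_singletons)
  then have "\<exists>v\<in>V. is_arg_max (swamp_Gamma E w r) (\<lambda>S. S \<subseteq> V \<and> S \<noteq> {}) {v}"
    unfolding swamp_Gamma_def by (rule ex_singleton_is_arg_max_average[OF V])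
  then show ?thesis
    unfolding swamp_optimal_def .
qed

end
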